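(* Let $\mathcal F$ be a function ring over a field $K$ and let $F$ be a set of polynomials in $\mathcal F\setminus\{o\}$. Then $F$ is a weak reductive Gröbner basis of $\mathrm{ideal}(F)$ if and only if (1) for all $f\in F$ and all monomials $m,l\in M(\mathcal F)$ the multiple $m\star f\star l$ has a reductive standard representation in terms of $F$, and (2) for all $p,q\in F$ (not necessarily different) and every tuple $(t,u_1,u_2,v_1,v_2)\in\mathcal C_s(p,q)$ the s-polynomial $\mathrm{spol}(p,q,t,u_1,u_2,v_1,v_2)$ has a reductive standard representation in terms of $F$.
   Context: Function ring: $T$ is a set, $K$ a field, and $\mathcal F$ is the set of functions $f:T\to K$ with finite support $\mathrm{supp}(f)$; $\mathcal F$ has pointwise addition, zero function $o$, scalar multiplication $(\alpha\cdot f)(t)=(f\cdot\alpha)(t)=\alpha f(t)$, and a multiplication $\star:\mathcal F\times\mathcal F\to\mathcal F$ making it an associative ring (not necessarily with unit) such that $(\alpha\cdot f)\star g=\alpha\cdot(f\star g)$ and $f\star(g\cdot\alpha)=(f\star g)\cdot\alpha$. Elements of $\mathcal F$ are called polynomials. $M(\mathcal F)$ is the set of monomials (functions with one-element support); monomials with coefficient $1$ are identified with elements of $T$ (terms). $\mathrm{ideal}(F)=\{\sum_{i=1}^n g_i\star f_i\star h_i\mid f_i\in F,\ g_i,h_i\in\mathcal F,\ n\in\mathbb N\}$. $\succeq$ is a fixed total well-founded ordering on $T$. For $f\ne o$, $\operatorname{HT}(f)$ is the $\succeq$-largest element of $\mathrm{supp}(f)$ and $\operatorname{HC}(f)=f(\operatorname{HT}(f))$;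 $\operatorname{HT}(S)=\{\operatorname{HT}(f)\mid f\in S\}$. An inequality $t\succ\operatorname{HT}(h)$ is regarded as satisfied if $h=o$; an equality $\operatorname{HT}(h)=t$ presupposes $h\ne o$. $\geq$ is a fixed reductive restriction of $\succeq$: a partial well-founded ordering on $T$ such that $t\ge s$ implies $t\succeq s$, and such that for $t,t_1,t_2,w_1,w_2\in T$: if $t_2\ge t_1$, $t_1\succ t$ and $t_2=\operatorname{HT}(w_1\star t_1\star w_2)$, then $t_2\succ\operatorname{HT}(w_1\star t\star w_2)$. A reductive standard representation of $g\neq o$ in terms of $F$ is a representation $g=\sum_{i=1}^n m_i\star f_i\star l_i$, $f_i\in F$, $m_i,l_i\in M(\mathcal F)$, such that for some $k\ge1$: $\operatorname{HT}(g)=\operatorname{HT}(m_i\star f_i\star l_i)=\operatorname{HT}(m_i\star\operatorname{HT}(f_i)\star l_i)\ge\operatorname{HT}(f_i)$ for $1\le i\le k$ and $\operatorname{HT}(g)\succ\operatorname{HT}(m_i\star f_i\star l_i)$ for $k<i\le n$. The empty sum is the reductive standard representation of $o$. $F\subseteq\mathcal F\setminus\{o\}$ is a weak reductive Gröbner basis of $\mathrm{ideal}(F)$ if $\operatorname{HT}(\mathrm{ideal}(F)\setminus\{o\})=\operatorname{HT}(\{m\star f\star l\mid f\in F,\ m,l\in M(\mathcal F),\ \operatorname{HT}(m\star f\star l)=\operatorname{HT}(m\star\operatorname{HT}(f)\star l)\ge\operatorname{HT}(f)\}\setminus\{o\})$. For non-zero $p,q$: $\mathcal C_s(p,q)$ is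 the set of $(t,u_1,u_2,v_1,v_2)\in T^5$ with $\operatorname{HT}(u_1\star p\star v_1)=\operatorname{HT}(u_1\star\operatorname{HT}(p)\star v_1)=t=\operatorname{HT}(u_2\star q\star v_2)=\operatorname{HT}(u_2\star\operatorname{HT}(q)\star v_2)$, $\operatorname{HT}(p)\le t$ and $\operatorname{HT}(q)\le t$; and $\mathrm{spol}(p,q,t,u_1,u_2,v_1,v_2)=\operatorname{HC}(u_1\star p\star v_1)^{-1}\cdot u_1\star p\star v_1-\operatorname{HC}(u_2\star q\star v_2)^{-1}\cdot u_2\star q\star v_2$. *)

theory Defs
  imports "HOL-Library.Poly_Mapping"
begin

text \<open>
  The set \<open>T\<close> of terms is a type \<open>'t\<close>, and the finitely supported functions from \<open>T\<close> to \<open>K\<close>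
  are the type \<open>'t \<Rightarrow>\<^sub>0 'k\<close>. The multiplication is an arbitrary parameter; in particular it is
  unrelated to the convolution product that \<open>Poly_Mapping\<close> defines when \<open>'t\<close> is a monoid.
\<close>

definition scale :: "'k::field \<Rightarrow> ('t \<Rightarrow>\<^sub>0 'k) \<Rightarrow> ('t \<Rightarrow>\<^sub>0 'k)" where
  "scale c f = Poly_Mapping.map ((*) c) f"

text \<open>
  Associative, not necessarily unital. Since \<open>K\<close> is commutative, left and right scalar
  multiplication are both \<open>scale\<close>.
\<close>

locale function_ring =
  fixes mult :: "('t \<Rightarrow>\<^sub>0 'k::field) \<Rightarrow> ('t \<Rightarrow>\<^sub>0 'k) \<Rightarrow> ('t \<Rightarrow>\<^sub>0 'k)" (infixl "\<star>" 70)
  assumes mult_assoc: "(f \<star> g) \<star> h = f \<star> (g \<star> h)"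
    and mult_distrib_right: "(f + g) \<star> h = f \<star> h + g \<star> h"
    and mult_distrib_left: "f \<star> (g + h) = f \<star> g + f \<star> h"
    and scale_mult_left: "scale c f \<star> g = scale c (f \<star> g)"
    and scale_mult_right: "f \<star> scale c g = scale c (f \<star> g)"

definition monomials :: "('t \<Rightarrow>\<^sub>0 'k::field) set" where
  "monomials = {m. card (Poly_Mapping.keys m) = 1}"

text \<open>The identification of a term with the monomial that has coefficient 1.\<close>

definition of_term :: "'t \<Rightarrow> ('t \<Rightarrow>\<^sub>0 'k::field)" where
  "of_term t = Poly_Mapping.single t 1"

text \<open>\<open>t \<succ> s\<close> is always the irreflexive part of \<open>t \<succeq> s\<close>.\<close>

definition total_wf_ordering :: "('t \<Rightarrow> 't \<Rightarrow> bool) \<Rightarrow> bool" where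
  "total_wf_ordering ge \<longleftrightarrow> well_order_on UNIV {(s, t). ge t s}"

definition partial_wf_ordering :: "('t \<Rightarrow> 't \<Rightarrow> bool) \<Rightarrow> bool" where
  "partial_wf_ordering ge \<longleftrightarrow>
     partial_order_on UNIV {(s, t). ge t s} \<and> wf ({(s, t). ge t s} - Id)"

context
  fixes succeq :: "'t \<Rightarrow> 't \<Rightarrow> bool" (infix "\<succeq>" 50)
begin

text \<open>The head term is meaningful only for nonzero polynomials; it is unspecified at 0.\<close>

definition HT :: "('t \<Rightarrow>\<^sub>0 'k::field) \<Rightarrow> 't" where
  "HT f = (THE t. t \<in> Poly_Mapping.keys f \<and> (\<forall>s\<in>Poly_Mapping.keys f. t \<succeq> s))"

definition HC :: "('t \<Rightarrow>\<^sub>0 'k::field) \<Rightarrow> 'k" where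
  "HC f = Poly_Mapping.lookup f (HT f)"

text \<open>The conventions for the zero polynomial: \<open>HT(h) = t\<close> entails that \<open>h\<close> is nonzero, whereas
  \<open>t \<succ> HT(h)\<close> holds for \<open>h = 0\<close>.\<close>

definition HT_eq :: "('t \<Rightarrow>\<^sub>0 'k::field) \<Rightarrow> 't \<Rightarrow> bool" where
  "HT_eq h t \<longleftrightarrow> h \<noteq> 0 \<and> HT h = t"

definition succ_HT :: "'t \<Rightarrow> ('t \<Rightarrow>\<^sub>0 'k::field) \<Rightarrow> bool" where
  "succ_HT t h \<longleftrightarrow> h = 0 \<or> (t \<succeq> HT h \<and> t \<noteq> HT h)"

end

context
  fixes mult :: "('t \<Rightarrow>\<^sub>0 'k::field) \<Rightarrow> ('t \<Rightarrow>\<^sub>0 'k) \<Rightarrow> ('t \<Rightarrow>\<^sub>0 'k)" (infixl "\<star>" 70)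
begin

definition ideal :: "('t \<Rightarrow>\<^sub>0 'k) set \<Rightarrow> ('t \<Rightarrow>\<^sub>0 'k) set" where
  "ideal F = {\<Sum>i=1..n. g i \<star> f i \<star> h i | (n::nat) g f h. \<forall>i\<in>{1..n}. f i \<in> F}"

context
  fixes succeq :: "'t \<Rightarrow> 't \<Rightarrow> bool" (infix "\<succeq>" 50)
begin

definition spol ::
  "('t \<Rightarrow>\<^sub>0 'k) \<Rightarrow> ('t \<Rightarrow>\<^sub>0 'k) \<Rightarrow> 't \<Rightarrow> 't \<Rightarrow> 't \<Rightarrow> 't \<Rightarrow> 't \<Rightarrow> ('t \<Rightarrow>\<^sub>0 'k)" where
  "spol p q t u1 u2 v1 v2 =
     scale (inverse (HC (\<succeq>) (of_term u1 \<star> p \<star> of_term v1))) (of_term u1 \<star> p \<star> of_term v1)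
     - scale (inverse (HC (\<succeq>) (of_term u2 \<star> q \<star> of_term v2))) (of_term u2 \<star> q \<star> of_term v2)"

context
  fixes geq :: "'t \<Rightarrow> 't \<Rightarrow> bool" (infix "\<ge>\<^sub>r" 50)
begin

definition reductive_restriction :: bool where
  "reductive_restriction \<longleftrightarrow>
     partial_wf_ordering (\<ge>\<^sub>r)
     \<and> (\<forall>t s. t \<ge>\<^sub>r s \<longrightarrow> t \<succeq> s)
     \<and> (\<forall>t t1 t2 w1 w2.
           t2 \<ge>\<^sub>r t1 \<and> t1 \<succeq> t \<and> t1 \<noteq> t
           \<and> HT_eq (\<succeq>) (of_term w1 \<star> of_term t1 \<star> of_term w2) t2
           \<longrightarrow> succ_HT (\<succeq>) t2 (of_term w1 \<star> of_term t \<star> of_term w2))"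

text \<open>\<open>t = HT(m \<star> f \<star> l) = HT(m \<star> HT(f) \<star> l) \<ge> HT(f)\<close>, for nonzero \<open>f\<close>\<close>

definition reductive_HT :: "'t \<Rightarrow> ('t \<Rightarrow>\<^sub>0 'k) \<Rightarrow> ('t \<Rightarrow>\<^sub>0 'k) \<Rightarrow> ('t \<Rightarrow>\<^sub>0 'k) \<Rightarrow> bool" where
  "reductive_HT t m f l \<longleftrightarrow>
     HT_eq (\<succeq>) (m \<star> f \<star> l) t
     \<and> HT_eq (\<succeq>) (m \<star> of_term (HT (\<succeq>) f) \<star> l) t
     \<and> t \<ge>\<^sub>r HT (\<succeq>) f"

definition has_reductive_standard_rep :: "('t \<Rightarrow>\<^sub>0 'k) set \<Rightarrow> ('t \<Rightarrow>\<^sub>0 'k) \<Rightarrow> bool" where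
  "has_reductive_standard_rep F g \<longleftrightarrow>
     g = 0 \<or>
     (\<exists>(n::nat) (k::nat) m f l.
        (\<forall>i\<in>{1..n}. f i \<in> F \<and> m i \<in> monomials \<and> l i \<in> monomials)
        \<and> g = (\<Sum>i=1..n. m i \<star> f i \<star> l i)
        \<and> 1 \<le> k \<and> k \<le> n
        \<and> (\<forall>i\<in>{1..k}. reductive_HT (HT (\<succeq>) g) (m i) (f i) (l i))
        \<and> (\<forall>i\<in>{k<..n}. succ_HT (\<succeq>) (HT (\<succeq>) g) (m i \<star> f i \<star> l i)))"

definition weak_reductive_Groebner_basis :: "('t \<Rightarrow>\<^sub>0 'k) set \<Rightarrow> bool" where
  "weak_reductive_Groebner_basis F \<longleftrightarrow>
     HT (\<succeq>) ` (ideal F - {0}) =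
     HT (\<succeq>) ` ({m \<star> f \<star> l | m f l. f \<in> F \<and> m \<in> monomials \<and> l \<in> monomials
                     \<and> reductive_HT (HT (\<succeq>) (m \<star> f \<star> l)) m f l} - {0})"

definition Cs :: "('t \<Rightarrow>\<^sub>0 'k) \<Rightarrow> ('t \<Rightarrow>\<^sub>0 'k) \<Rightarrow> ('t \<times> 't \<times> 't \<times> 't \<times> 't) set" where
  "Cs p q = {(t, u1, u2, v1, v2).
     reductive_HT t (of_term u1) p (of_term v1) \<and> reductive_HT t (of_term u2) q (of_term v2)}"

end
end
end

end

theory Submission
  imports Defs "HOL.Vector_Spaces"
begin

text \<open>
  Every element of \<open>ideal F\<close> is a sum of monomial multiples \<open>m \<star> f \<star> l\<close>, and condition (1), iterated
  along the well-ordering, turns it into a combination of multiples that are reductive at their own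
  head term. Let \<open>t\<close> be minimal such that a given \<open>g\<close> is a combination of reductive multiples with
  head terms \<open>\<preceq> t\<close>. By condition (2), any two reductive multiples with head term \<open>t\<close> agree up to a
  scalar and a combination of reductive multiples with head terms \<open>\<prec> t\<close>, so \<open>g\<close> is \<open>c \<cdot> w\<close> plus such
  a combination, for one multiple \<open>w\<close> with head term \<open>t\<close>. Minimality gives \<open>c \<noteq> 0\<close>, hence
  \<open>HT g = t = HT w\<close>. Conversely, over a weak reductive Groebner basis, subtracting a multiple with the
  same head term and recursing yields a representation of any element of the ideal.
\<close>

section \<open>Polynomials as a vector space spanned by the monomials\<close>

lemma lookup_scale [simp]: "Poly_Mapping.lookup (scale c f) t = c * Poly_Mapping.lookup f t"
  by (simp add: scale_def map.rep_eq when_def)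

text \<open>Makes spans, subspaces and span induction available for combinations of polynomials;
  only the pointwise structure enters.\<close>

interpretation fun_space: vector_space "scale :: 'k::field \<Rightarrow> ('t \<Rightarrow>\<^sub>0 'k) \<Rightarrow> 't \<Rightarrow>\<^sub>0 'k"
  by unfold_locales (auto intro!: poly_mapping_eqI simp: lookup_add algebra_simps)

lemma keys_scale: "c \<noteq> 0 \<Longrightarrow> Poly_Mapping.keys (scale c f) = Poly_Mapping.keys f"
  by (auto simp: in_keys_iff)

lemma of_term_in_monomials: "of_term t \<in> monomials"
  by (simp add: monomials_def of_term_def)

lemma scale_in_monomials: "m \<in> monomials \<Longrightarrow> c \<noteq> 0 \<Longrightarrow> scale c m \<in> monomials"
  by (simp add: monomials_def keys_scale)

lemma monomialsE:
  assumes "m \<in> monomials"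
  obtains c u where "c \<noteq> 0" "m = scale c (of_term u)"
proof -
  from assms obtain u where u: "Poly_Mapping.keys m = {u}"
    by (auto simp: monomials_def card_1_singleton_iff)
  have "Poly_Mapping.lookup m s = 0" if "s \<noteq> u" for s
    using u that by (metis in_keys_iff singletonD)
  hence "m = scale (Poly_Mapping.lookup m u) (of_term u)"
    by (intro poly_mapping_eqI) (auto simp: of_term_def lookup_single when_def)
  moreover have "Poly_Mapping.lookup m u \<noteq> 0"
    using u by (metis in_keys_iff singletonI)
  ultimately show thesis using that by blast
qed

text \<open>Expansion by coefficients. Linear statements about arbitrary factors thereby reduce to
  monomial factors.\<close>

lemma in_span_monomials: "f \<in> fun_space.span monomials"
proof -
  have "f = (\<Sum>t\<in>Poly_Mapping.keys f. scale (Poly_Mapping.lookup f t) (of_term t))"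
  proof (rule poly_mapping_eqI)
    fix s
    have "(\<Sum>t\<in>Poly_Mapping.keys f. Poly_Mapping.lookup f t * (1 when t = s)) =
        (\<Sum>t\<in>Poly_Mapping.keys f. if t = s then Poly_Mapping.lookup f t else 0)"
      by (intro sum.cong) (auto simp: when_def)
    also have "\<dots> = Poly_Mapping.lookup f s"
      by (auto simp: sum.delta' in_keys_iff)
    finally show "Poly_Mapping.lookup f s = Poly_Mapping.lookup
        (\<Sum>t\<in>Poly_Mapping.keys f. scale (Poly_Mapping.lookup f t) (of_term t)) s"
      by (simp add: lookup_sum of_term_def lookup_single)
  qed
  also have "\<dots> \<in> fun_space.span monomials"
    by (intro fun_space.span_sum fun_space.span_scale fun_space.span_base of_term_in_monomials)
  finally show ?thesis .
qed

locale ordered_function_ring = function_ring mult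
  for mult :: "('t \<Rightarrow>\<^sub>0 'k::field) \<Rightarrow> ('t \<Rightarrow>\<^sub>0 'k) \<Rightarrow> ('t \<Rightarrow>\<^sub>0 'k)" (infixl "\<star>" 70) +
  fixes succeq :: "'t \<Rightarrow> 't \<Rightarrow> bool" (infix "\<succeq>" 50)
    and geq :: "'t \<Rightarrow> 't \<Rightarrow> bool" (infix "\<ge>\<^sub>r" 50)
  assumes succeq_total_wf: "total_wf_ordering (\<succeq>)"
begin

abbreviation reductive where "reductive \<equiv> reductive_HT (\<star>) (\<succeq>) (\<ge>\<^sub>r)"
abbreviation standard_rep where "standard_rep \<equiv> has_reductive_standard_rep (\<star>) (\<succeq>) (\<ge>\<^sub>r)"

section \<open>Head terms with respect to the well-ordering\<close>

lemma succeq_antisym: "s \<succeq> t \<Longrightarrow> t \<succeq> s \<Longrightarrow> s = t"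
  and succeq_trans: "s \<succeq> t \<Longrightarrow> t \<succeq> u \<Longrightarrow> s \<succeq> u"
  and succeq_refl: "s \<succeq> s"
  and succeq_total: "s \<succeq> t \<or> t \<succeq> s"
  and succ_wf: "wf {(s, t). t \<succeq> s \<and> t \<noteq> s}"
proof -
  have ord: "well_order_on UNIV {(s, t). t \<succeq> s}"
    using succeq_total_wf by (simp add: total_wf_ordering_def)
  hence r: "refl {(s, t). t \<succeq> s}" "trans {(s, t). t \<succeq> s}" "antisym {(s, t). t \<succeq> s}"
      "total {(s, t). t \<succeq> s}" "wf ({(s, t). t \<succeq> s} - Id)"
    by (auto simp: well_order_on_def linear_order_on_def partial_order_on_def preorder_on_def)
  show "s \<succeq> t \<Longrightarrow> t \<succeq> s \<Longrightarrow> s = t" using r(3) by (auto simp: antisym_def)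
  show "s \<succeq> t \<Longrightarrow> t \<succeq> u \<Longrightarrow> s \<succeq> u" using r(2) unfolding trans_def by blast
  show refl: "s \<succeq> s" for s using r(1) by (auto simp: refl_on_def)
  show "s \<succeq> t \<or> t \<succeq> s" using r(4) refl by (cases "s = t") (auto simp: total_on_def)
  have "{(s, t). t \<succeq> s} - Id = {(s, t). t \<succeq> s \<and> t \<noteq> s}" by auto
  with r(5) show "wf {(s, t). t \<succeq> s \<and> t \<noteq> s}" by simp
qed

lemma succ_induct [case_names less]:
  assumes "\<And>t. (\<And>s. t \<succeq> s \<Longrightarrow> s \<noteq> t \<Longrightarrow> P s) \<Longrightarrow> P t"
  shows "P t"
  using succ_wf by (rule wf_induct_rule) (auto intro: assms)

lemma HT_eqI:
  assumes "t \<in> Poly_Mapping.keys h" "\<And>s. s \<in> Poly_Mapping.keys h \<Longrightarrow> t \<succeq> s"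
  shows "HT_eq (\<succeq>) h t"
  unfolding HT_eq_def HT_def
proof
  show "h \<noteq> 0" using assms(1) by auto
  show "(THE t. t \<in> Poly_Mapping.keys h \<and> (\<forall>s\<in>Poly_Mapping.keys h. t \<succeq> s)) = t"
    using assms succeq_antisym by (intro the_equality) auto
qed

lemma HT_eq_HT:
  assumes "h \<noteq> 0"
  shows "HT_eq (\<succeq>) h (HT (\<succeq>) h)"
  using assms by (simp add: HT_eq_def)

lemma finite_has_greatest:
  assumes "finite A" "A \<noteq> {}"
  shows "\<exists>t\<in>A. \<forall>s\<in>A. t \<succeq> s"
  using assms
proof (induction rule: finite_ne_induct)
  case (singleton x)
  then show ?case by (simp add: succeq_refl)
next
  case (insert x A)
  then obtain t where "t \<in> A" "\<forall>s\<in>A. t \<succeq> s" by auto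
  then show ?case
    using succeq_total[of t x] succeq_trans succeq_refl by (metis insert_iff)
qed

text \<open>A finite nonempty support has a greatest element, so the description by
  \<open>THE\<close> becomes a condition on the support. The zero polynomial is excluded on both
  sides, its support being empty.\<close>

lemma HT_eq_iff:
  "HT_eq (\<succeq>) h t \<longleftrightarrow> t \<in> Poly_Mapping.keys h \<and> (\<forall>s\<in>Poly_Mapping.keys h. t \<succeq> s)"
proof
  assume h: "HT_eq (\<succeq>) h t"
  then obtain t' where "t' \<in> Poly_Mapping.keys h" "\<forall>s\<in>Poly_Mapping.keys h. t' \<succeq> s"
    using finite_has_greatest[of "Poly_Mapping.keys h"] by (auto simp: HT_eq_def)
  with HT_eqI[of t' h] h show "t \<in> Poly_Mapping.keys h \<and> (\<forall>s\<in>Poly_Mapping.keys h. t \<succeq> s)"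
    by (auto simp: HT_eq_def)
qed (auto intro: HT_eqI)

text \<open>For the zero polynomial the right side holds vacuously, in line with the convention. In
  this form the condition visibly passes to linear combinations.\<close>

lemma succ_HT_iff: "succ_HT (\<succeq>) t h \<longleftrightarrow> (\<forall>s\<in>Poly_Mapping.keys h. t \<succeq> s \<and> t \<noteq> s)"
proof (cases "h = 0")
  case False
  hence "HT_eq (\<succeq>) h (HT (\<succeq>) h)" by (rule HT_eq_HT)
  with False show ?thesis
    unfolding HT_eq_iff succ_HT_def by (metis succeq_antisym succeq_trans)
qed (simp add: succ_HT_def)

lemma HT_eq_scale: "c \<noteq> 0 \<Longrightarrow> HT_eq (\<succeq>) (scale c h) t \<longleftrightarrow> HT_eq (\<succeq>) h t"
  by (simp add: HT_eq_iff keys_scale)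

lemma HC_eq: "HT_eq (\<succeq>) h t \<Longrightarrow> HC (\<succeq>) h = Poly_Mapping.lookup h t"
  by (simp add: HC_def HT_eq_def)

lemma HC_nonzero: "HT_eq (\<succeq>) h t \<Longrightarrow> HC (\<succeq>) h \<noteq> 0"
  by (simp add: HC_eq HT_eq_iff in_keys_iff)

lemma subspace_keys: "fun_space.subspace {x :: 't \<Rightarrow>\<^sub>0 'k. Poly_Mapping.keys x \<subseteq> A}"
  unfolding fun_space.subspace_def
  by (auto simp: in_keys_iff subset_iff lookup_add)
    (metis add.right_neutral)+

lemma subspace_succ_HT: "fun_space.subspace {x :: 't \<Rightarrow>\<^sub>0 'k. succ_HT (\<succeq>) t x}"
  using subspace_keys[of "{s. t \<succeq> s \<and> t \<noteq> s}"] by (simp add: succ_HT_iff subset_iff Ball_def)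

text \<open>The scalar makes the coefficients at \<open>t\<close> cancel; every other term of either
  support is already below \<open>t\<close>.\<close>

lemma succ_HT_diff_scale:
  assumes x: "HT_eq (\<succeq>) x t" and y: "HT_eq (\<succeq>) y t"
  shows "succ_HT (\<succeq>) t (x - scale (HC (\<succeq>) x / HC (\<succeq>) y) y)"
  unfolding succ_HT_iff
proof
  let ?d = "x - scale (HC (\<succeq>) x / HC (\<succeq>) y) y"
  fix s assume s: "s \<in> Poly_Mapping.keys ?d"
  have "Poly_Mapping.lookup ?d t = 0"
    using HC_nonzero[OF y] HC_eq[OF x] HC_eq[OF y] by (simp add: lookup_minus)
  moreover have "s \<in> Poly_Mapping.keys x \<or> s \<in> Poly_Mapping.keys y"
    using s by (auto simp: in_keys_iff lookup_minus)
  ultimately show "t \<succeq> s \<and> t \<noteq> s"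
    using s x y by (auto simp: HT_eq_iff in_keys_iff)
qed

section \<open>Bilinearity, and the filtration by head terms of reductive multiples\<close>

lemma mult_zero_left: "0 \<star> g = 0"
  using mult_distrib_right[of 0 0 g] by simp

lemma mult_zero_right: "g \<star> 0 = 0"
  using mult_distrib_left[of g 0 0] by simp

lemmas mult_linear = mult_zero_left mult_zero_right mult_distrib_left mult_distrib_right
  scale_mult_left scale_mult_right

definition multiples :: "('t \<Rightarrow>\<^sub>0 'k) set \<Rightarrow> ('t \<Rightarrow>\<^sub>0 'k) set" where
  "multiples F = {m \<star> f \<star> l | m f l. f \<in> F \<and> m \<in> monomials \<and> l \<in> monomials}"

definition reductive_multiples :: "'t \<Rightarrow> ('t \<Rightarrow>\<^sub>0 'k) set \<Rightarrow> ('t \<Rightarrow>\<^sub>0 'k) set" where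
  "reductive_multiples t F =
     {m \<star> f \<star> l | m f l. f \<in> F \<and> m \<in> monomials \<and> l \<in> monomials \<and> reductive t m f l}"

text \<open>\<open>below_span\<close> and \<open>atmost_span\<close> bound the head terms of the
  generators in a combination, not just that of the resulting element, which cancellation may make
  smaller. Closing this gap is the purpose of condition (2).\<close>

definition below_span :: "'t \<Rightarrow> ('t \<Rightarrow>\<^sub>0 'k) set \<Rightarrow> ('t \<Rightarrow>\<^sub>0 'k) set" where
  "below_span t F = fun_space.span (\<Union>s\<in>{s. t \<succeq> s \<and> t \<noteq> s}. reductive_multiples s F)"

definition atmost_span :: "'t \<Rightarrow> ('t \<Rightarrow>\<^sub>0 'k) set \<Rightarrow> ('t \<Rightarrow>\<^sub>0 'k) set" where
  "atmost_span t F = fun_space.span (\<Union>s\<in>{s. t \<succeq> s}. reductive_multiples s F)"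

lemma HT_eq_reductive_multiple: "w \<in> reductive_multiples t F \<Longrightarrow> HT_eq (\<succeq>) w t"
  by (auto simp: reductive_multiples_def reductive_HT_def)

lemma reductive_multiple_in_atmost_span: "w \<in> reductive_multiples t F \<Longrightarrow> w \<in> atmost_span t F"
  unfolding atmost_span_def using succeq_refl by (auto intro!: fun_space.span_base)

lemma atmost_span_mono: "t \<succeq> s \<Longrightarrow> atmost_span s F \<subseteq> atmost_span t F"
  unfolding atmost_span_def by (rule fun_space.span_mono) (auto intro: succeq_trans)

lemma atmost_span_below: "t \<succeq> s \<Longrightarrow> t \<noteq> s \<Longrightarrow> atmost_span s F \<subseteq> below_span t F"
  unfolding atmost_span_def below_span_def
  by (rule fun_space.span_mono) (use succeq_antisym in \<open>auto intro: succeq_trans\<close>)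

lemma below_span_succ_HT: "x \<in> below_span t F \<Longrightarrow> succ_HT (\<succeq>) t x"
proof -
  have "below_span t F \<subseteq> {x. succ_HT (\<succeq>) t x}"
    unfolding below_span_def
    by (rule fun_space.span_minimal[OF _ subspace_succ_HT])
      (auto dest!: HT_eq_reductive_multiple simp: HT_eq_def succ_HT_def)
  thus "x \<in> below_span t F \<Longrightarrow> succ_HT (\<succeq>) t x" by auto
qed

text \<open>Only finitely many generators are involved, and the largest of their head terms serves
  as \<open>s\<close>. Zero is set apart because there may be no term below
  \<open>t\<close>.\<close>

lemma below_spanE:
  assumes "x \<in> below_span t F" "x \<noteq> 0"
  obtains s where "t \<succeq> s" "t \<noteq> s" "x \<in> atmost_span s F"
proof -
  let ?S = "\<lambda>x. x = 0 \<or> (\<exists>s. t \<succeq> s \<and> t \<noteq> s \<and> x \<in> atmost_span s F)"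
  have "?S x" using assms(1) unfolding below_span_def
  proof (induction rule: fun_space.span_induct_alt)
    case (step c w y)
    then obtain s where s: "t \<succeq> s" "t \<noteq> s" "w \<in> atmost_span s F"
      using reductive_multiple_in_atmost_span by blast
    have cw: "scale c w \<in> atmost_span s F"
      using s(3) unfolding atmost_span_def by (rule fun_space.span_scale)
    from step.IH show ?case
    proof
      assume "y = 0"
      with cw s show ?thesis by auto
    next
      assume "\<exists>s. t \<succeq> s \<and> t \<noteq> s \<and> y \<in> atmost_span s F"
      then obtain s' where s': "t \<succeq> s'" "t \<noteq> s'" "y \<in> atmost_span s' F" by blast
      obtain r where r: "r \<succeq> s" "r \<succeq> s'" "r = s \<or> r = s'"
        using succeq_total[of s s'] succeq_refl by blast
      have "scale c w \<in> atmost_span r F" "y \<in> atmost_span r F"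
        using cw s'(3) atmost_span_mono r(1,2) by blast+
      hence "scale c w + y \<in> atmost_span r F"
        unfolding atmost_span_def by (rule fun_space.span_add)
      with r(3) s s' show ?thesis by blast
    qed
  qed simp
  with assms(2) that show thesis by blast
qed

section \<open>The ideal and the monomial multiples\<close>

lemma ideal_subset_span_multiples: "ideal (\<star>) F \<subseteq> fun_space.span (multiples F)"
proof -
  let ?V = "fun_space.span (multiples F)"
  have "g \<star> f \<star> h \<in> ?V" if f: "f \<in> F" for g f h
  proof -
    \<comment> \<open>The product is linear in \<open>g\<close> and in \<open>h\<close>, so the
      claim passes from monomials to all polynomials one argument at a time: first in
      \<open>h\<close> with a monomial on the left, then in \<open>g\<close>.\<close>
    have sub: "fun_space.subspace {g. g \<star> f \<star> h \<in> ?V}" "fun_space.subspace {h. g \<star> f \<star> h \<in> ?V}" for g h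
      unfolding fun_space.subspace_def
      by (auto simp: mult_linear
          intro: fun_space.span_zero fun_space.span_add fun_space.span_scale)
    have "m \<star> f \<star> h \<in> ?V" if m: "m \<in> monomials" for m
    proof -
      have "fun_space.span monomials \<subseteq> {h. m \<star> f \<star> h \<in> ?V}"
        by (rule fun_space.span_minimal[OF _ sub(2)])
          (use m f in \<open>auto intro!: fun_space.span_base simp: multiples_def\<close>)
      thus ?thesis using in_span_monomials[of h] by blast
    qed
    hence "fun_space.span monomials \<subseteq> {g. g \<star> f \<star> h \<in> ?V}"
      by (intro fun_space.span_minimal[OF _ sub(1)]) auto
    thus ?thesis using in_span_monomials[of g] by blast
  qed
  thus ?thesis
    by (auto simp: ideal_def intro!: fun_space.span_sum)
qed

text \<open>The ideal consists of indexed sums, so the new summand is appended at index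
  \<open>Suc n\<close>, with the scalar absorbed into its left factor.\<close>

lemma ideal_add_multiple:
  assumes "x \<in> ideal (\<star>) F" "f \<in> F"
  shows "x + scale c (g \<star> f \<star> h) \<in> ideal (\<star>) F"
proof -
  from assms(1) obtain n :: nat and g' f' h' where
    n: "x = (\<Sum>i=1..n. g' i \<star> f' i \<star> h' i)" "\<forall>i\<in>{1..n}. f' i \<in> F"
    unfolding ideal_def by blast
  let ?g = "g'(Suc n := scale c g)" and ?f = "f'(Suc n := f)" and ?h = "h'(Suc n := h)"
  have "x + scale c (g \<star> f \<star> h) = (\<Sum>i=1..Suc n. ?g i \<star> ?f i \<star> ?h i)"
    by (simp add: n(1) scale_mult_left)
  moreover have "\<forall>i\<in>{1..Suc n}. ?f i \<in> F"
    using n(2) assms(2) by auto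
  ultimately show ?thesis unfolding ideal_def by blast
qed

lemma zero_in_ideal: "0 \<in> ideal (\<star>) F"
  unfolding ideal_def by (auto intro!: exI[of _ "0::nat"])

lemma multiple_in_ideal: "f \<in> F \<Longrightarrow> scale c (g \<star> f \<star> h) \<in> ideal (\<star>) F"
  using ideal_add_multiple[OF zero_in_ideal] by fastforce

section \<open>Weak reductive Groebner bases in terms of reductive multiples\<close>

lemma reductive_multiple_HTs:
  "HT (\<succeq>) ` ({m \<star> f \<star> l | m f l. f \<in> F \<and> m \<in> monomials \<and> l \<in> monomials
       \<and> reductive (HT (\<succeq>) (m \<star> f \<star> l)) m f l} - {0}) = {t. reductive_multiples t F \<noteq> {}}"
  (is "?L = ?R")
proof
  show "?L \<subseteq> ?R" by (auto simp: reductive_multiples_def)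
  show "?R \<subseteq> ?L"
  proof
    fix t assume "t \<in> ?R"
    then obtain m f l where mfl: "f \<in> F" "m \<in> monomials" "l \<in> monomials" "reductive t m f l"
      by (auto simp: reductive_multiples_def)
    hence "m \<star> f \<star> l \<noteq> 0" "HT (\<succeq>) (m \<star> f \<star> l) = t"
      by (auto simp: reductive_HT_def HT_eq_def)
    with mfl show "t \<in> ?L" by (intro image_eqI[of _ _ "m \<star> f \<star> l"]) auto
  qed
qed

lemma reductive_multiple_HTs_subset: "{t. reductive_multiples t F \<noteq> {}} \<subseteq> HT (\<succeq>) ` (ideal (\<star>) F - {0})"
proof
  fix t assume "t \<in> {t. reductive_multiples t F \<noteq> {}}"
  then obtain w where w: "w \<in> reductive_multiples t F" by auto
  then obtain m f l where "f \<in> F" "w = m \<star> f \<star> l" by (auto simp: reductive_multiples_def)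
  hence "w \<in> ideal (\<star>) F" using multiple_in_ideal[of f F 1 m l] by simp
  with HT_eq_reductive_multiple[OF w] show "t \<in> HT (\<succeq>) ` (ideal (\<star>) F - {0})"
    by (auto simp: HT_eq_def)
qed

text \<open>A reductive multiple is itself a nonzero element of the ideal, so one inclusion between
  the two sets of head terms is automatic and only the other one has content.\<close>

lemma weak_reductive_Groebner_basis_iff:
  "weak_reductive_Groebner_basis (\<star>) (\<succeq>) (\<ge>\<^sub>r) F \<longleftrightarrow>
     (\<forall>g\<in>ideal (\<star>) F - {0}. reductive_multiples (HT (\<succeq>) g) F \<noteq> {})"
  unfolding weak_reductive_Groebner_basis_def reductive_multiple_HTs
  using reductive_multiple_HTs_subset[of F] by blast

section \<open>From Groebner bases to standard representations\<close>

lemma reductive_scale: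
  assumes "a \<noteq> 0" "b \<noteq> 0"
  shows "reductive t (scale a m) f (scale b l) \<longleftrightarrow> reductive t m f l"
  using assms by (simp add: reductive_HT_def scale_mult_left scale_mult_right HT_eq_scale)

text \<open>The reductive multiple is put in front of a representation of the difference. All
  summands of the latter, its own leading ones included, fall below the head term of
  \<open>g\<close>, so the new representation has k = 1.\<close>

lemma standard_rep_extend:
  assumes mfl: "f \<in> F" "m \<in> monomials" "l \<in> monomials" "reductive (HT (\<succeq>) g) m f l"
    and rep: "standard_rep F (g - m \<star> f \<star> l)"
    and less: "succ_HT (\<succeq>) (HT (\<succeq>) g) (g - m \<star> f \<star> l)"
  shows "standard_rep F g"
proof -
  let ?t = "HT (\<succeq>) g"
  obtain n :: nat and m' f' l' where
    n: "\<forall>i\<in>{1..n}. f' i \<in> F \<and> m' i \<in> monomials \<and> l' i \<in> monomials"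
      "g - m \<star> f \<star> l = (\<Sum>i=1..n. m' i \<star> f' i \<star> l' i)"
      "\<forall>i\<in>{1..n}. succ_HT (\<succeq>) ?t (m' i \<star> f' i \<star> l' i)"
  proof (cases "g - m \<star> f \<star> l = 0")
    case True
    then show thesis by (intro that[of 0]) auto
  next
    case False
    let ?s = "HT (\<succeq>) (g - m \<star> f \<star> l)"
    from rep False obtain n k :: nat and m' f' l' where
      n: "\<forall>i\<in>{1..n}. f' i \<in> F \<and> m' i \<in> monomials \<and> l' i \<in> monomials"
        "g - m \<star> f \<star> l = (\<Sum>i=1..n. m' i \<star> f' i \<star> l' i)" and
      k: "\<forall>i\<in>{1..k}. reductive ?s (m' i) (f' i) (l' i)"
        "\<forall>i\<in>{k<..n}. succ_HT (\<succeq>) ?s (m' i \<star> f' i \<star> l' i)"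
      unfolding has_reductive_standard_rep_def by blast
    have "?t \<succeq> ?s" "?t \<noteq> ?s" using less False by (auto simp: succ_HT_def)
    \<comment> \<open>The first \<open>k\<close> summands have head term \<open>?s\<close>; the
      others are zero or have a smaller one.\<close>
    moreover have "m' i \<star> f' i \<star> l' i = 0 \<or> ?s \<succeq> HT (\<succeq>) (m' i \<star> f' i \<star> l' i)"
      if "i \<in> {1..n}" for i
      using k that by (cases "i \<le> k") (auto simp: reductive_HT_def HT_eq_def succ_HT_def succeq_refl)
    ultimately have "\<forall>i\<in>{1..n}. succ_HT (\<succeq>) ?t (m' i \<star> f' i \<star> l' i)"
      unfolding succ_HT_def by (metis succeq_antisym succeq_trans)
    with n show thesis by (rule that)
  qed
  \<comment> \<open>The new summand takes index 1 and the old ones move up by one.\<close>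
  let ?m = "\<lambda>i. if i = 1 then m else m' (i - 1)"
  let ?f = "\<lambda>i. if i = 1 then f else f' (i - 1)"
  let ?l = "\<lambda>i. if i = 1 then l else l' (i - 1)"
  have shift: "i - 1 \<in> {1..n}" if "i \<in> {1..Suc n}" "i \<noteq> 1" for i
    using that by auto
  have "(\<Sum>i=1..Suc n. ?m i \<star> ?f i \<star> ?l i) = m \<star> f \<star> l + (\<Sum>i=Suc 1..Suc n. ?m i \<star> ?f i \<star> ?l i)"
    by (subst sum.atLeast_Suc_atMost) auto
  also have "(\<Sum>i=Suc 1..Suc n. ?m i \<star> ?f i \<star> ?l i) = (\<Sum>i=1..n. m' i \<star> f' i \<star> l' i)"
    unfolding sum.shift_bounds_cl_Suc_ivl by (intro sum.cong) auto
  finally have g: "g = (\<Sum>i=1..Suc n. ?m i \<star> ?f i \<star> ?l i)"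
    using n(2) by (simp add: algebra_simps)
  have F: "\<forall>i\<in>{1..Suc n}. ?f i \<in> F \<and> ?m i \<in> monomials \<and> ?l i \<in> monomials"
    using n(1) mfl shift by simp
  have head: "\<forall>i\<in>{1..1}. reductive ?t (?m i) (?f i) (?l i)"
    using mfl(4) by simp
  have tail: "\<forall>i\<in>{1<..Suc n}. succ_HT (\<succeq>) ?t (?m i \<star> ?f i \<star> ?l i)"
    using n(3) shift by auto
  show ?thesis
    unfolding has_reductive_standard_rep_def
    by (rule disjI2, rule exI[of _ "Suc n"], rule exI[of _ 1], rule exI[of _ ?m],
        rule exI[of _ ?f], rule exI[of _ ?l]) (intro conjI F g head tail, simp_all)
qed

text \<open>Division: cancel the head term of \<open>g\<close> by a reductive multiple, which stays
  inside the ideal, and recurse on the smaller head term.\<close>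

lemma Groebner_basis_standard_rep:
  assumes G: "weak_reductive_Groebner_basis (\<star>) (\<succeq>) (\<ge>\<^sub>r) F" and g: "g \<in> ideal (\<star>) F"
  shows "standard_rep F g"
proof (cases "g = 0")
  case False
  define t where "t = HT (\<succeq>) g"
  from t_def g False show ?thesis
  proof (induction t arbitrary: g rule: succ_induct)
    case (less t)
    from G less.prems obtain w where w: "w \<in> reductive_multiples t F"
      by (auto simp: weak_reductive_Groebner_basis_iff)
    then obtain m f l where
      mfl: "w = m \<star> f \<star> l" "f \<in> F" "m \<in> monomials" "l \<in> monomials" "reductive t m f l"
      by (auto simp: reductive_multiples_def)
    note wt = HT_eq_reductive_multiple[OF w]
    have gt: "HT_eq (\<succeq>) g t" using less.prems by (simp add: HT_eq_def)
    \<comment> \<open>The quotient that makes the head coefficients cancel. Being nonzero, it can be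
      absorbed into the monomial \<open>m\<close>.\<close>
    define c where "c = HC (\<succeq>) g / HC (\<succeq>) w"
    have c: "c \<noteq> 0" using HC_nonzero[OF wt] HC_nonzero[OF gt] by (simp add: c_def)
    have succ: "succ_HT (\<succeq>) t (g - scale c w)"
      unfolding c_def using gt wt by (rule succ_HT_diff_scale)
    have "g - scale c w \<in> ideal (\<star>) F"
      using ideal_add_multiple[OF less.prems(2) mfl(2), of "-c" m l]
      by (simp add: mfl(1) fun_space.scale_minus_left)
    \<comment> \<open>A zero difference has no specified head term to recurse on, but is represented
      trivially.\<close>
    hence "standard_rep F (g - scale c w)"
      using less.IH[of "HT (\<succeq>) (g - scale c w)"] succ
      by (cases "g - scale c w = 0") (auto simp: succ_HT_def has_reductive_standard_rep_def)
    moreover have "scale c w = scale c m \<star> f \<star> l"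
      by (simp add: mfl(1) scale_mult_left)
    moreover have "reductive t (scale c m) f l"
      using reductive_scale[of c 1 t m f l] c mfl(5) by simp
    ultimately show ?case
      using standard_rep_extend[of f F "scale c m" l g] succ mfl scale_in_monomials[OF _ c]
        less.prems(1) by auto
  qed
qed (simp add: has_reductive_standard_rep_def)

lemma spol_in_ideal:
  assumes "p \<in> F" "q \<in> F"
  shows "spol (\<star>) (\<succeq>) p q t u1 u2 v1 v2 \<in> ideal (\<star>) F"
  unfolding spol_def
  using ideal_add_multiple[OF multiple_in_ideal[OF assms(1)] assms(2)]
  by (metis add_uminus_conv_diff fun_space.scale_minus_left)

section \<open>From conditions (1) and (2) to Groebner bases\<close>

text \<open>The leading summands are reductive multiples, whereas the others need not be reductive.
  The assumption \<open>tail\<close> deals with those: it is the induction hypothesis when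
  \<open>g\<close> is a multiple, and the outcome of that induction when \<open>g\<close> is an
  s-polynomial.\<close>

lemma standard_rep_in_atmost_span:
  assumes rep: "standard_rep F g" and "g \<noteq> 0"
    and tail: "\<And>w. w \<in> multiples F \<Longrightarrow> w \<noteq> 0 \<Longrightarrow> HT (\<succeq>) g \<succeq> HT (\<succeq>) w \<Longrightarrow> HT (\<succeq>) w \<noteq> HT (\<succeq>) g
      \<Longrightarrow> w \<in> atmost_span (HT (\<succeq>) w) F"
  shows "g \<in> atmost_span (HT (\<succeq>) g) F"
proof -
  let ?t = "HT (\<succeq>) g"
  from assms(1,2) obtain n k :: nat and m f l where
    n: "\<forall>i\<in>{1..n}. f i \<in> F \<and> m i \<in> monomials \<and> l i \<in> monomials"
      "g = (\<Sum>i=1..n. m i \<star> f i \<star> l i)"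
      "\<forall>i\<in>{1..k}. reductive ?t (m i) (f i) (l i)"
      "\<forall>i\<in>{k<..n}. succ_HT (\<succeq>) ?t (m i \<star> f i \<star> l i)"
    unfolding has_reductive_standard_rep_def by blast
  have zero: "0 \<in> atmost_span ?t F"
    unfolding atmost_span_def by (rule fun_space.span_zero)
  have "m i \<star> f i \<star> l i \<in> atmost_span ?t F" if i: "i \<in> {1..n}" for i
  proof (cases "i \<le> k")
    case True
    with i n have "m i \<star> f i \<star> l i \<in> reductive_multiples ?t F"
      unfolding reductive_multiples_def by fastforce
    thus ?thesis by (rule reductive_multiple_in_atmost_span)
  next
    case False
    let ?w = "m i \<star> f i \<star> l i"
    have w: "?w = 0 \<or> ?t \<succeq> HT (\<succeq>) ?w \<and> ?t \<noteq> HT (\<succeq>) ?w"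
      using False i n(4) by (auto simp: succ_HT_def)
    have "?w \<in> multiples F" using i n(1) unfolding multiples_def by blast
    hence "?w \<in> atmost_span (HT (\<succeq>) ?w) F" if "?w \<noteq> 0"
      using tail w that by metis
    with w zero atmost_span_mono[of ?t "HT (\<succeq>) ?w" F] show ?thesis by (cases "?w = 0") auto
  qed
  hence "(\<Sum>i=1..n. m i \<star> f i \<star> l i) \<in> atmost_span ?t F"
    unfolding atmost_span_def by (intro fun_space.span_sum)
  thus ?thesis using n(2) by metis
qed

text \<open>Well-founded induction on the head term: the non-leading summands of a representation
  are again multiples, zero or with smaller head terms, and are rewritten in turn.\<close>

lemma multiple_in_atmost_span:
  assumes rep: "\<And>w. w \<in> multiples F \<Longrightarrow> standard_rep F w"
    and w: "w \<in> multiples F" "w \<noteq> 0"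
  shows "w \<in> atmost_span (HT (\<succeq>) w) F"
proof -
  define t where "t = HT (\<succeq>) w"
  from t_def w show ?thesis
    by (induction t arbitrary: w rule: succ_induct)
      (rule standard_rep_in_atmost_span[OF rep], auto)
qed

text \<open>The coefficients of the two monomials only scale the product, so they disappear when the
  head coefficient is normalized to 1. What remains has terms as outer factors, as in
  \<open>Cs\<close> and \<open>spol\<close>.\<close>

lemma normalized_reductive_multiple:
  assumes "w \<in> reductive_multiples t F"
  obtains u f v where "f \<in> F" "reductive t (of_term u) f (of_term v)"
    "scale (inverse (HC (\<succeq>) w)) w =
     scale (inverse (HC (\<succeq>) (of_term u \<star> f \<star> of_term v))) (of_term u \<star> f \<star> of_term v)"
proof -
  from assms obtain m f l where
    mfl: "w = m \<star> f \<star> l" "f \<in> F" "m \<in> monomials" "l \<in> monomials" "reductive t m f l"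
    by (auto simp: reductive_multiples_def)
  from mfl(3) obtain a u where a: "a \<noteq> 0" "m = scale a (of_term u)" by (rule monomialsE)
  from mfl(4) obtain b v where b: "b \<noteq> 0" "l = scale b (of_term v)" by (rule monomialsE)
  let ?x = "of_term u \<star> f \<star> of_term v"
  have red: "reductive t (of_term u) f (of_term v)"
    using mfl(5) a b reductive_scale by blast
  have w: "w = scale (a * b) ?x"
    by (simp add: mfl(1) a b scale_mult_left scale_mult_right mult.commute)
  have "HC (\<succeq>) w = a * b * HC (\<succeq>) ?x"
    using HC_eq[OF HT_eq_reductive_multiple[OF assms]] HC_eq[of ?x t] red
    by (simp add: w reductive_HT_def)
  hence "scale (inverse (HC (\<succeq>) w)) w = scale (inverse (HC (\<succeq>) ?x)) ?x"
    using a(1) b(1) by (simp add: w field_simps)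
  with that mfl(2) red show thesis by blast
qed

text \<open>The difference is a scalar multiple of an s-polynomial.\<close>

lemma reductive_multiples_proportional:
  assumes mult_rep: "\<And>w. w \<in> multiples F \<Longrightarrow> standard_rep F w"
    and spol_rep: "\<And>p q t u1 u2 v1 v2. p \<in> F \<Longrightarrow> q \<in> F \<Longrightarrow> (t, u1, u2, v1, v2) \<in> Cs (\<star>) (\<succeq>) (\<ge>\<^sub>r) p q
      \<Longrightarrow> standard_rep F (spol (\<star>) (\<succeq>) p q t u1 u2 v1 v2)"
    and x: "x \<in> reductive_multiples t F" and y: "y \<in> reductive_multiples t F"
  shows "y - scale (HC (\<succeq>) y / HC (\<succeq>) x) x \<in> below_span t F"
proof -
  let ?n = "\<lambda>w. scale (inverse (HC (\<succeq>) w)) w" and ?s = "\<lambda>w. HC (\<succeq>) w"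
  note HT_xy = HT_eq_reductive_multiple[OF x] HT_eq_reductive_multiple[OF y]
  note nz = HC_nonzero[OF HT_xy(1)] HC_nonzero[OF HT_xy(2)]
  obtain p u1 v1 where p: "p \<in> F" "reductive t (of_term u1) p (of_term v1)"
      "?n y = ?n (of_term u1 \<star> p \<star> of_term v1)"
    using normalized_reductive_multiple[OF y] by metis
  obtain q u2 v2 where q: "q \<in> F" "reductive t (of_term u2) q (of_term v2)"
      "?n x = ?n (of_term u2 \<star> q \<star> of_term v2)"
    using normalized_reductive_multiple[OF x] by metis
  define d where "d = spol (\<star>) (\<succeq>) p q t u1 u2 v1 v2"
  have d: "d = ?n y - ?n x" by (simp add: d_def spol_def p(3) q(3))
  \<comment> \<open>Multiplying by the head coefficient of \<open>y\<close> turns the two normalized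
    parts of \<open>d\<close> into \<open>y\<close> and the matching multiple of
    \<open>x\<close>.\<close>
  have diff: "y - scale (HC (\<succeq>) y / HC (\<succeq>) x) x = scale (HC (\<succeq>) y) d"
    using nz by (simp add: d fun_space.scale_right_diff_distrib divide_inverse)
  have rep: "standard_rep F d"
    unfolding d_def using p q by (intro spol_rep) (auto simp: Cs_def)
  have "d \<in> below_span t F"
  proof (cases "d = 0")
    case True
    then show ?thesis by (simp add: below_span_def fun_space.span_zero)
  next
    case False
    \<comment> \<open>The heads of \<open>y\<close> and \<open>x\<close> cancel, so \<open>d\<close>
      lies strictly below \<open>t\<close>; its standard representation then leads to reductive
      multiples below \<open>t\<close> only.\<close>
    have "succ_HT (\<succeq>) t (scale (HC (\<succeq>) y) d)"
      unfolding diff[symmetric] using HT_xy(2,1) by (rule succ_HT_diff_scale)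
    hence "succ_HT (\<succeq>) t d" using nz(2) by (simp add: succ_HT_iff keys_scale)
    with False have "t \<succeq> HT (\<succeq>) d" "t \<noteq> HT (\<succeq>) d" by (auto simp: succ_HT_def)
    moreover have "d \<in> atmost_span (HT (\<succeq>) d) F"
      by (rule standard_rep_in_atmost_span[OF rep False multiple_in_atmost_span[OF mult_rep]])
    ultimately show ?thesis using atmost_span_below by blast
  qed
  thus ?thesis unfolding diff below_span_def by (rule fun_space.span_scale)
qed

text \<open>Modulo \<open>below_span t F\<close>, the space \<open>atmost_span t F\<close> is
  spanned by \<open>x\<close> alone: generators with head term \<open>t\<close> are congruent to
  multiples of \<open>x\<close>, and all others vanish.\<close>

lemma atmost_span_decompose:
  assumes mult_rep: "\<And>w. w \<in> multiples F \<Longrightarrow> standard_rep F w"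
    and spol_rep: "\<And>p q t u1 u2 v1 v2. p \<in> F \<Longrightarrow> q \<in> F \<Longrightarrow> (t, u1, u2, v1, v2) \<in> Cs (\<star>) (\<succeq>) (\<ge>\<^sub>r) p q
      \<Longrightarrow> standard_rep F (spol (\<star>) (\<succeq>) p q t u1 u2 v1 v2)"
    and x: "x \<in> reductive_multiples t F" and y: "y \<in> atmost_span t F"
  shows "\<exists>c. y - scale c x \<in> below_span t F"
  using y unfolding atmost_span_def
proof (induction rule: fun_space.span_induct_alt)
  case base
  show ?case by (intro exI[of _ 0]) (simp add: below_span_def fun_space.span_zero)
next
  case (step a w z)
  from step.hyps obtain s where s: "t \<succeq> s" "w \<in> reductive_multiples s F" by blast
  have "\<exists>b. w - scale b x \<in> below_span t F"
  proof (cases "s = t")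
    case True
    with s reductive_multiples_proportional[OF mult_rep spol_rep x] show ?thesis by blast
  next
    case False
    with s have "w \<in> below_span t F" unfolding below_span_def by (auto intro: fun_space.span_base)
    thus ?thesis by (intro exI[of _ 0]) simp
  qed
  then obtain b where b: "w - scale b x \<in> below_span t F" by blast
  from step.IH obtain c where c: "z - scale c x \<in> below_span t F" by blast
  have "scale a (w - scale b x) + (z - scale c x) \<in> below_span t F"
    using b c unfolding below_span_def by (intro fun_space.span_add fun_space.span_scale)
  moreover have "scale a (w - scale b x) + (z - scale c x) = (scale a w + z) - scale (a * b + c) x"
    by (simp add: fun_space.scale_right_diff_distrib fun_space.scale_left_distrib)
  ultimately show ?case by metis
qed

text \<open>The bound \<open>t\<close> is lowered until it is attained as the head term of
  \<open>g\<close>; well-foundedness ends the descent.\<close>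

lemma HT_atmost_span:
  assumes mult_rep: "\<And>w. w \<in> multiples F \<Longrightarrow> standard_rep F w"
    and spol_rep: "\<And>p q t u1 u2 v1 v2. p \<in> F \<Longrightarrow> q \<in> F \<Longrightarrow> (t, u1, u2, v1, v2) \<in> Cs (\<star>) (\<succeq>) (\<ge>\<^sub>r) p q
      \<Longrightarrow> standard_rep F (spol (\<star>) (\<succeq>) p q t u1 u2 v1 v2)"
    and g: "g \<in> atmost_span t F" "g \<noteq> 0"
  shows "reductive_multiples (HT (\<succeq>) g) F \<noteq> {}"
  using g(1)
proof (induction t rule: succ_induct)
  case (less t)
  \<comment> \<open>Membership in \<open>below_span t F\<close> supplies a smaller bound, which is
    the descent step in the first two cases below.\<close>
  have IH: ?case if "g \<in> below_span t F"
    using below_spanE[OF that g(2)] less.IH by metis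
  show ?case
  proof (cases "reductive_multiples t F = {}")
    case True
    \<comment> \<open>No generator has head term exactly \<open>t\<close>, so the two spans have the
      same generators.\<close>
    hence "atmost_span t F \<subseteq> below_span t F"
      unfolding atmost_span_def below_span_def by (intro fun_space.span_mono) auto
    with less.prems IH show ?thesis by blast
  next
    case False
    then obtain x where x: "x \<in> reductive_multiples t F" by blast
    obtain c where c: "g - scale c x \<in> below_span t F"
      using atmost_span_decompose[OF mult_rep spol_rep x less.prems] by blast
    show ?thesis
    proof (cases "c = 0")
      case True
      with c IH show ?thesis by simp
    next
      case nz: False
      note xt = HT_eq_reductive_multiple[OF x] and h = below_span_succ_HT[OF c]
      \<comment> \<open>The term \<open>t\<close> occurs in \<open>scale c x\<close> but not in the
        remainder, whose support lies below \<open>t\<close>; hence it survives in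
        \<open>g\<close>.\<close>
      have "HT_eq (\<succeq>) g t"
      proof (rule HT_eqI)
        have "Poly_Mapping.lookup (g - scale c x) t = 0"
          using h by (auto simp: succ_HT_iff in_keys_iff)
        thus "t \<in> Poly_Mapping.keys g"
          using xt nz by (auto simp: HT_eq_iff in_keys_iff lookup_minus)
      next
        fix s assume "s \<in> Poly_Mapping.keys g"
        hence "s \<in> Poly_Mapping.keys (g - scale c x) \<or> s \<in> Poly_Mapping.keys x"
          by (auto simp: in_keys_iff lookup_minus)
        thus "t \<succeq> s" using h xt by (auto simp: succ_HT_iff HT_eq_iff)
      qed
      with False show ?thesis by (simp add: HT_eq_def)
    qed
  qed
qed

text \<open>Condition (1) bounds each multiple separately, and by totality the larger of two bounds
  serves for a sum.\<close>

lemma span_multiples_in_atmost_span: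
  assumes mult_rep: "\<And>w. w \<in> multiples F \<Longrightarrow> standard_rep F w"
    and g: "g \<in> fun_space.span (multiples F)"
  shows "\<exists>t. g \<in> atmost_span t F"
  using g
proof (induction rule: fun_space.span_induct_alt)
  case base
  show ?case by (simp add: atmost_span_def fun_space.span_zero)
next
  case (step c w y)
  from step.IH obtain s where s: "y \<in> atmost_span s F" by blast
  have "\<exists>r. w \<in> atmost_span r F"
    using multiple_in_atmost_span[OF mult_rep step.hyps]
    by (cases "w = 0") (auto simp: atmost_span_def fun_space.span_zero)
  then obtain r where r: "w \<in> atmost_span r F" by blast
  obtain t where "t \<succeq> r" "t \<succeq> s" using succeq_total[of r s] succeq_refl by blast
  with r s have "w \<in> atmost_span t F" "y \<in> atmost_span t F" using atmost_span_mono by blast+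
  hence "scale c w + y \<in> atmost_span t F"
    unfolding atmost_span_def by (intro fun_space.span_add fun_space.span_scale)
  thus ?case by blast
qed

lemma weak_reductive_Groebner_basisI:
  assumes mult_rep: "\<And>w. w \<in> multiples F \<Longrightarrow> standard_rep F w"
    and spol_rep: "\<And>p q t u1 u2 v1 v2. p \<in> F \<Longrightarrow> q \<in> F \<Longrightarrow> (t, u1, u2, v1, v2) \<in> Cs (\<star>) (\<succeq>) (\<ge>\<^sub>r) p q
      \<Longrightarrow> standard_rep F (spol (\<star>) (\<succeq>) p q t u1 u2 v1 v2)"
  shows "weak_reductive_Groebner_basis (\<star>) (\<succeq>) (\<ge>\<^sub>r) F"
  unfolding weak_reductive_Groebner_basis_iff
proof
  fix g assume g: "g \<in> ideal (\<star>) F - {0}"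
  hence "g \<in> fun_space.span (multiples F)" using ideal_subset_span_multiples by blast
  then obtain t where "g \<in> atmost_span t F"
    using span_multiples_in_atmost_span[OF mult_rep] by blast
  with g HT_atmost_span[OF mult_rep spol_rep] show "reductive_multiples (HT (\<succeq>) g) F \<noteq> {}"
    by blast
qed

end

theorem theorem4p4p15:
  fixes mult :: "('t \<Rightarrow>\<^sub>0 'k::field) \<Rightarrow> ('t \<Rightarrow>\<^sub>0 'k) \<Rightarrow> ('t \<Rightarrow>\<^sub>0 'k)" (infixl "\<star>" 70)
    and succeq :: "'t \<Rightarrow> 't \<Rightarrow> bool" (infix "\<succeq>" 50)
    and geq :: "'t \<Rightarrow> 't \<Rightarrow> bool" (infix "\<ge>\<^sub>r" 50)
    and F :: "('t \<Rightarrow>\<^sub>0 'k) set"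
  assumes "function_ring (\<star>)"
    and "total_wf_ordering (\<succeq>)"
    and "reductive_restriction (\<star>) (\<succeq>) (\<ge>\<^sub>r)"
    and "0 \<notin> F"
  shows "weak_reductive_Groebner_basis (\<star>) (\<succeq>) (\<ge>\<^sub>r) F \<longleftrightarrow>
      (\<forall>f\<in>F. \<forall>m\<in>monomials. \<forall>l\<in>monomials.
         has_reductive_standard_rep (\<star>) (\<succeq>) (\<ge>\<^sub>r) F (m \<star> f \<star> l))
    \<and> (\<forall>p\<in>F. \<forall>q\<in>F. \<forall>(t, u1, u2, v1, v2)\<in>Cs (\<star>) (\<succeq>) (\<ge>\<^sub>r) p q.
         has_reductive_standard_rep (\<star>) (\<succeq>) (\<ge>\<^sub>r) F (spol (\<star>) (\<succeq>) p q t u1 u2 v1 v2))"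
  (is "?G \<longleftrightarrow> ?mult \<and> ?spol")
proof -
  interpret ordered_function_ring "(\<star>)" "(\<succeq>)" "(\<ge>\<^sub>r)"
    using assms by (simp add: ordered_function_ring_def ordered_function_ring_axioms_def)
  show ?thesis
  proof
    assume G: ?G
    note rep = Groebner_basis_standard_rep[OF G]
    have ?mult using rep multiple_in_ideal[of _ F 1] by simp
    moreover have ?spol using rep spol_in_ideal by blast
    ultimately show "?mult \<and> ?spol" ..
  next
    assume "?mult \<and> ?spol"
    thus ?G by (intro weak_reductive_Groebner_basisI) (auto simp: multiples_def, blast)
  qed
qed

end
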